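(* Let $\gamma_i>0$ and $\lambda>0$. For $u\in\mathbb{R}$, let $$\mathcal{L}^*(u;\gamma_i):=\min_{0\leq z_i\leq 1}\ \lambda z_i-\gamma_i(1-u)^2+\gamma_i\frac{(1-u)_+^2}{z_i}+\gamma_i\frac{(1-u)_-^2}{1-z_i}.$$ Then, as a function of $u$, this optimal value is the non-convex function $$\mathcal{L}^*(u;\gamma_i)=\begin{cases}0 & \text{if } 1-u\leq 0,\\ 2\sqrt{\lambda\gamma_i}\,(1-u)-\gamma_i(1-u)^2 & \text{if } 0<1-u\leq\sqrt{\lambda/\gamma_i},\\ \lambda & \text{if } 1-u>\sqrt{\lambda/\gamma_i}.\end{cases}$$
   Context: In the application, $u=y_i\bm{x}_i^\top\bm{w}$ is the margin of a data point $\bm{x}_i\in\mathbb{R}^p$ with label $y_i\in\{-1,1\}$ for a classifier $\bm{w}\in\mathbb{R}^p$. For $\alpha\in\mathbb{R}$, $(\alpha)_+:=\max\{\alpha,0\}$ and $(\alpha)_-:=\max\{-\alpha,0\}$, and $(\alpha)_\pm^2:=((\alpha)_\pm)^2$. Convention for division by $0$: for $a\in\mathbb{R}$, $a^2/0=0$ if $a=0$ and $a^2/0=+\infty$ otherwise. *)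

theory Defs
  imports "HOL-Analysis.Analysis"
begin

definition pos_part :: "real \<Rightarrow> real" where
  "pos_part a = max a 0"

definition neg_part :: "real \<Rightarrow> real" where
  "neg_part a = max (- a) 0"

(* The convention a^2/0 = 0 for a = 0 and +infinity otherwise is exactly what
   division on ereal gives (inverse 0 = \<infinity> and 0 * \<infinity> = 0), so the objective is
   written with ereal division; the next lemma records this. *)
lemma ereal_square_divide:
  fixes a b :: real
  shows "ereal (a\<^sup>2) / ereal b =
    (if b = 0 then (if a = 0 then 0 else \<infinity>) else ereal (a\<^sup>2 / b))"
  by (auto simp: divide_ereal_def ereal_mult_eq_PInfty divide_inverse)

definition margin_objective :: "real \<Rightarrow> real \<Rightarrow> real \<Rightarrow> real \<Rightarrow> ereal" where
  "margin_objective lam gam u z =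
     ereal (lam * z) - ereal (gam * (1 - u)\<^sup>2)
     + ereal gam * (ereal ((pos_part (1 - u))\<^sup>2) / ereal z)
     + ereal gam * (ereal ((neg_part (1 - u))\<^sup>2) / ereal (1 - z))"

(* An infimum; that it is a minimum, i.e. attained, has to be asserted separately. *)
definition Lstar :: "real \<Rightarrow> real \<Rightarrow> real \<Rightarrow> ereal" where
  "Lstar lam gam u = (INF z\<in>{0..1}. margin_objective lam gam u z)"

end

theory Submission
  imports Defs
begin

text \<open>
  Only one of the two fractions is nonzero. For $u \ge 1$ the objective is nonnegative and vanishes
  at $z = 0$. For $t = 1 - u > 0$ it is $\lambda z + \gamma t^2 / z - \gamma t^2$, which by AM-GM is
  at least $2 \sqrt{\lambda\gamma}\, t - \gamma t^2$, with equality at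
  $z = t / \sqrt{\lambda/\gamma}$ if this lies in $[0,1]$; otherwise the minimum is at $z = 1$.
  The resulting function is constant and positive for small $u$ but vanishes at $u = 1$, which
  violates convexity.
\<close>

text \<open>The fraction over \<open>z\<close> has numerator 0, so it vanishes even at
  \<open>z = 0\<close>. At \<open>z = 1\<close> the other one is infinite unless
  \<open>u = 1\<close>; in that case it is 0/0, which is 0 both in \<open>ereal\<close> and in
  \<open>real\<close>, so the real formula stays valid.\<close>

lemma margin_objective_nonpos:
  assumes "gam > 0" and "1 - u \<le> 0"
  shows "margin_objective lam gam u z =
    (if z = 1 \<and> u \<noteq> 1 then \<infinity>
     else ereal (lam * z - gam * (1 - u)\<^sup>2 + gam * ((1 - u)\<^sup>2 / (1 - z))))"
proof -
  have "pos_part (1 - u) = 0" "neg_part (1 - u) = - (1 - u)"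
    using assms by (auto simp: pos_part_def neg_part_def)
  then show ?thesis
    using assms unfolding margin_objective_def ereal_square_divide by (auto simp: power2_commute)
qed

lemma margin_objective_pos:
  assumes "gam > 0" and "0 < 1 - u"
  shows "margin_objective lam gam u z =
    (if z = 0 then \<infinity>
     else ereal (lam * z - gam * (1 - u)\<^sup>2 + gam * ((1 - u)\<^sup>2 / z)))"
proof -
  have "pos_part (1 - u) = 1 - u" "neg_part (1 - u) = 0"
    using assms by (auto simp: pos_part_def neg_part_def)
  then show ?thesis
    using assms unfolding margin_objective_def ereal_square_divide by auto
qed

text \<open>AM-GM in exact form: the gap is \<open>(s * z - r)\<^sup>2 / z\<close>, which vanishes
  precisely at \<open>z = r / s\<close>.\<close>

lemma two_mult_le_add_divide:
  fixes s r z :: real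
  assumes "0 < z"
  shows "2 * s * r \<le> s\<^sup>2 * z + r\<^sup>2 / z"
proof -
  have "s\<^sup>2 * z + r\<^sup>2 / z - 2 * s * r = (s * z - r)\<^sup>2 / z"
    using assms by (simp add: field_simps power2_eq_square)
  moreover have "(s * z - r)\<^sup>2 / z \<ge> 0"
    using assms by simp
  ultimately show ?thesis by linarith
qed

text \<open>The gap factors as \<open>(1 - z) * (r\<^sup>2 - s\<^sup>2 * z) / z\<close>, and
  \<open>s\<^sup>2 * z\<close> \<le> \<open>s\<^sup>2\<close> \<le> \<open>r\<^sup>2\<close>. This
  covers the case where \<open>r / s\<close> may leave the unit interval and the endpoint
  \<open>z = 1\<close> is optimal.\<close>

lemma square_le_add_divide_diff:
  fixes s r z :: real
  assumes "0 < z" "z \<le> 1" "0 \<le> s" "s \<le> r"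
  shows "s\<^sup>2 \<le> s\<^sup>2 * z - r\<^sup>2 + r\<^sup>2 / z"
proof -
  have "s\<^sup>2 * z - r\<^sup>2 + r\<^sup>2 / z - s\<^sup>2 = (1 - z) * (r\<^sup>2 - s\<^sup>2 * z) / z"
    using assms by (simp add: field_simps power2_eq_square)
  moreover have "s\<^sup>2 * z \<le> r\<^sup>2"
    using assms mult_left_le[of z "s\<^sup>2"] power_mono[of s r 2] by (meson order_trans zero_le_power2)
  then have "(1 - z) * (r\<^sup>2 - s\<^sup>2 * z) / z \<ge> 0"
    using assms by simp
  ultimately show ?thesis by linarith
qed

text \<open>A minimizer together with a matching lower bound gives both the value of the infimum and
  its attainment.\<close>

lemma margin_objective_minimum:
  fixes lam gam u :: real
  assumes gam: "gam > 0" and lam: "lam > 0"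
  defines "v \<equiv> ereal
          (if 1 - u \<le> 0 then 0
           else if 1 - u \<le> sqrt (lam / gam)
             then 2 * sqrt (lam * gam) * (1 - u) - gam * (1 - u)\<^sup>2
           else lam)"
  shows "\<exists>z\<in>{0..1}. margin_objective lam gam u z = v \<and>
           (\<forall>y\<in>{0..1}. v \<le> margin_objective lam gam u y)"
proof (cases "1 - u \<le> 0")
  case True
  have v: "v = 0"
    using True by (simp add: v_def zero_ereal_def)
  have "0 \<le> margin_objective lam gam u y" if y: "y \<in> {0..1}" for y
  proof (cases "y = 1")
    case True
    then show ?thesis
      using \<open>1 - u \<le> 0\<close> gam lam by (simp add: margin_objective_nonpos)
  next
    case False
    \<comment> \<open>Since \<open>1 - y\<close> lies in (0,1], dividing by it does not decrease the
      square, so the fraction compensates the negative term.\<close>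
    then have "(1 - u)\<^sup>2 \<le> (1 - u)\<^sup>2 / (1 - y)"
      using y by (simp add: field_simps mult_left_le)
    then have "gam * (1 - u)\<^sup>2 \<le> gam * ((1 - u)\<^sup>2 / (1 - y))"
      using gam by (simp only: mult_le_cancel_left_pos)
    moreover have "0 \<le> lam * y"
      using lam y by simp
    ultimately have "0 \<le> lam * y - gam * (1 - u)\<^sup>2 + gam * ((1 - u)\<^sup>2 / (1 - y))"
      by linarith
    then show ?thesis
      using False \<open>1 - u \<le> 0\<close> gam by (simp add: margin_objective_nonpos)
  qed
  moreover have "margin_objective lam gam u 0 = 0"
    using True gam by (simp add: margin_objective_nonpos)
  ultimately show ?thesis
    unfolding v by (intro bexI[of _ 0]) auto
next
  case False
  then have t: "0 < 1 - u" by simp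
  \<comment> \<open>Rescaling absorbs both parameters: the objective becomes
    \<open>s\<^sup>2 * z - r\<^sup>2 + r\<^sup>2 / z\<close>, and the threshold on
    \<open>1 - u\<close> becomes \<open>r \<le> s\<close>.\<close>
  define s where "s = sqrt lam"
  define r where "r = sqrt gam * (1 - u)"
  have pos: "0 < s" "0 < r" and s2: "s\<^sup>2 = lam" and r2: "r\<^sup>2 = gam * (1 - u)\<^sup>2"
    using gam lam t by (auto simp: s_def r_def power_mult_distrib)
  have thr: "1 - u \<le> sqrt (lam / gam) \<longleftrightarrow> r \<le> s"
    using gam by (simp add: s_def r_def real_sqrt_divide pos_le_divide_eq mult.commute)
  have v: "v = ereal (if r \<le> s then 2 * s * r - r\<^sup>2 else s\<^sup>2)"
    using False unfolding v_def thr s2 r2 by (simp add: s_def r_def real_sqrt_mult)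
  have obj: "margin_objective lam gam u z =
      (if z = 0 then \<infinity> else ereal (s\<^sup>2 * z - r\<^sup>2 + r\<^sup>2 / z))" for z
    using margin_objective_pos[OF gam t] by (simp add: s2 r2)
  have "v \<le> margin_objective lam gam u y" if "y \<in> {0..1}" for y
    using that two_mult_le_add_divide[of y s r] square_le_add_divide_diff[of y s r] pos
    by (auto simp: v obj)
  moreover have "\<exists>z\<in>{0..1}. margin_objective lam gam u z = v"
  proof (cases "r \<le> s")
    case True
    \<comment> \<open>The equality case of AM-GM; \<open>r \<le> s\<close> makes
      \<open>r / s\<close> feasible.\<close>
    have "s\<^sup>2 * (r / s) - r\<^sup>2 + r\<^sup>2 / (r / s) = 2 * s * r - r\<^sup>2"
      using pos by (simp add: field_simps power2_eq_square)
    then have "margin_objective lam gam u (r / s) = v"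
      using pos True by (simp add: v obj)
    then show ?thesis
      using pos True by (intro bexI[of _ "r / s"]) auto
  next
    case False
    then show ?thesis
      by (intro bexI[of _ 1]) (auto simp: v obj)
  qed
  ultimately show ?thesis by blast
qed

theorem proposition1:
  fixes gam lam :: real
  assumes "gam > 0" and "lam > 0"
  shows "(\<forall>u. \<exists>z\<in>{0..1}. margin_objective lam gam u z = Lstar lam gam u)
    \<and> (\<forall>u. Lstar lam gam u = ereal
          (if 1 - u \<le> 0 then 0
           else if 1 - u \<le> sqrt (lam / gam)
             then 2 * sqrt (lam * gam) * (1 - u) - gam * (1 - u)\<^sup>2
           else lam))
    \<and> \<not> convex_on UNIV (\<lambda>u. real_of_ereal (Lstar lam gam u))"
proof -
  define v where "v u = ereal
          (if 1 - u \<le> 0 then 0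
           else if 1 - u \<le> sqrt (lam / gam)
             then 2 * sqrt (lam * gam) * (1 - u) - gam * (1 - u)\<^sup>2
           else lam)" for u
  have min: "\<exists>z\<in>{0..1}. margin_objective lam gam u z = v u \<and>
           (\<forall>y\<in>{0..1}. v u \<le> margin_objective lam gam u y)" for u
    unfolding v_def by (rule margin_objective_minimum[OF assms])
  have val: "Lstar lam gam u = v u" for u
  proof -
    obtain z where "z \<in> {0..1}" "margin_objective lam gam u z = v u"
      and "\<forall>y\<in>{0..1}. v u \<le> margin_objective lam gam u y"
      using min by blast
    then show ?thesis
      unfolding Lstar_def by (metis INF_greatest INF_lower antisym)
  qed
  have att: "\<exists>z\<in>{0..1}. margin_objective lam gam u z = Lstar lam gam u" for u
    using min[of u] val by auto
  have "\<not> convex_on UNIV (\<lambda>u. real_of_ereal (Lstar lam gam u))"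
  proof
    assume "convex_on UNIV (\<lambda>u. real_of_ereal (Lstar lam gam u))"
    then have cvx: "convex_on UNIV (\<lambda>u. real_of_ereal (v u))"
      by (simp add: val)
    \<comment> \<open>The points \<open>1 - 2 * m\<close> and \<open>1 - 4 * m\<close> both lie
      strictly past the threshold, where the value is \<open>lam\<close>. The former is the midpoint
      of the latter and 1, where the value is 0, so convexity would force
      \<open>lam \<le> lam / 2\<close>.\<close>
    define m where "m = sqrt (lam / gam)"
    have "m > 0"
      using assms by (simp add: m_def)
    then have "v 1 = 0" "v (1 - 4 * m) = lam" "v (1 - 2 * m) = lam"
      unfolding v_def m_def[symmetric] by (auto simp: zero_ereal_def)
    moreover have "(1 - 1/2) *\<^sub>R 1 + (1/2) *\<^sub>R (1 - 4 * m) = 1 - 2 * m"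
      by (simp add: field_simps)
    ultimately show False
      using convex_onD[OF cvx, of "1/2" 1 "1 - 4 * m"] assms by simp
  qed
  then show ?thesis
    using att val unfolding v_def by blast
qed

end
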